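(* There exist an infinite sequence of integers $n$, matrices $M_n \in \{0,1\}^{m \times n}$ (with $m = m(n)$) each of whose columns has Hamming weight at most $3$, submatrices $A_n$ of $M_n$, and a constant $c > 0$, such that for every $n$ in the sequence: 1. there is a valid set of choices (i.e. a resolution of ties among lightest rows) for which the algorithm (P)ESS-FINDER run on $M_n$ outputs $A_n$; 2. $\dim_{\mathbb{F}_2}(\ker M_n) \le n/2 + 2$; 3. $\dim_{\mathbb{F}_2}(\ker A_n) \ge n/2 + c\,n$.
   Context: All matrices are over $\mathbb{F}_2$; $\ker M = \{x \in \mathbb{F}_2^n : Mx = 0\}$. For row index set $C \subseteq [m]$ and column index set $V \subseteq [n]$, $M(C,V)$ denotes the submatrix of $M$ with rows $C$ and columns $V$. The weight of a row or column is its number of ones. Procedure STRIP, applied to a submatrix $M(C,V)$: while the current submatrix has a column $x \in V$ of weight exactly $1$, remove the column $x$ from $V$ and remove from $C$ the row containing its unique $1$; when no such column remains, return the current submatrix (possibly empty). Algorithm (P)ESS-FINDER, with input a matrix $M \in \{0,1\}^{m \times n}$ in which every column has weight at most $3$: (1) Set $H \leftarrow M$, $C \leftarrow \emptyset$, $V \leftarrow \emptyset$. (2) While $C \ne [m]$ and $V \ne [n]$: (a) choose a row $c \notin C$ whose weight in the current matrix $H$ is minimal (a "lightest row"; when several rows are lightest, any of them may be chosen, and each such choice is a valid choice); let $V_c$ be the set of columns $j$ with $H(c,j)=1$; add $c$ to $C$, add $V_c$ to $V$, and set all entries of the columns $V_c$ of $H$ to zero. (b) If $V_c = \emptyset$ and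 STRIP$(M(C,V)) \ne \emptyset$, output STRIP$(M(C,V))$ and halt. (3) Return $M(C,V)$. *)

theory Defs
  imports
    Complex_Main
    "HOL-Library.Z2"
    "Jordan_Normal_Form.Matrix_Kernel"
    "Jordan_Normal_Form.DL_Submatrix"
begin

text \<open>
  Matrices over the two-element field are values of type \<^typ>\<open>bit mat\<close>. Rows and columns are
  indexed from 0, so the sets [m] and [n] become \<open>{0..<m}\<close> and \<open>{0..<n}\<close>. The submatrix
  M(C,V) is \<open>submatrix M C V\<close>; the procedures below work on the pair of index sets (C,V).
\<close>

definition row_support :: "bit mat \<Rightarrow> nat \<Rightarrow> nat set" where
  "row_support M i = {j. j < dim_col M \<and> M $$ (i, j) = 1}"

definition col_support :: "bit mat \<Rightarrow> nat \<Rightarrow> nat set" where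
  "col_support M j = {i. i < dim_row M \<and> M $$ (i, j) = 1}"

definition row_weight :: "bit mat \<Rightarrow> nat \<Rightarrow> nat" where
  "row_weight M i = card (row_support M i)"

definition col_weight :: "bit mat \<Rightarrow> nat \<Rightarrow> nat" where
  "col_weight M j = card (col_support M j)"

definition is_submatrix :: "bit mat \<Rightarrow> bit mat \<Rightarrow> bool" where
  "is_submatrix A M \<longleftrightarrow>
     (\<exists>C V. C \<subseteq> {0..<dim_row M} \<and> V \<subseteq> {0..<dim_col M} \<and> A = submatrix M C V)"

definition zero_cols :: "bit mat \<Rightarrow> nat set \<Rightarrow> bit mat" where
  "zero_cols H V = mat (dim_row H) (dim_col H) (\<lambda>(i, j). if j \<in> V then 0 else H $$ (i, j))"

text \<open>
  \<open>strip M C V C' V'\<close>: some run of STRIP on M(C,V) returns M(C',V'). The order in which columns of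
  weight 1 are removed is left open. It can affect which all-zero columns survive, but neither
  the set C' nor the cardinality of V'; in particular, whether the result is empty does not
  depend on the order.
\<close>

inductive strip :: "bit mat \<Rightarrow> nat set \<Rightarrow> nat set \<Rightarrow> nat set \<Rightarrow> nat set \<Rightarrow> bool" for M where
  strip_stop:
    "(\<forall>x\<in>V. card (col_support M x \<inter> C) \<noteq> 1) \<Longrightarrow> strip M C V C V"
| strip_remove:
    "x \<in> V \<Longrightarrow> col_support M x \<inter> C = {r} \<Longrightarrow> strip M (C - {r}) (V - {x}) C' V'
     \<Longrightarrow> strip M C V C' V'"

text \<open>
  A submatrix is empty if it has no entries, i.e. no rows or no columns. Requiring both to be
  absent would be inappropriate: STRIP removes equally many rows and columns, so it could then
  never return an empty submatrix from one with different numbers of rows and columns.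
\<close>

definition empty_sub :: "nat set \<Rightarrow> nat set \<Rightarrow> bool" where
  "empty_sub C V \<longleftrightarrow> C = {} \<or> V = {}"

definition lightest_row :: "bit mat \<Rightarrow> nat set \<Rightarrow> nat \<Rightarrow> bool" where
  "lightest_row H C c \<longleftrightarrow>
     c < dim_row H \<and> c \<notin> C \<and>
     (\<forall>c'. c' < dim_row H \<and> c' \<notin> C \<longrightarrow> row_weight H c \<le> row_weight H c')"

definition running :: "bit mat \<Rightarrow> nat set \<Rightarrow> nat set \<Rightarrow> bool" where
  "running M C V \<longleftrightarrow> C \<noteq> {0..<dim_row M} \<and> V \<noteq> {0..<dim_col M}"

text \<open>
  \<open>pess_loop M H C V A\<close>: started in state (H,C,V), the main loop on input M can output A. Every
  choice of a lightest row is admitted. When no new column is added, V \<union> row_support H c = V.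
\<close>

inductive pess_loop ::
  "bit mat \<Rightarrow> bit mat \<Rightarrow> nat set \<Rightarrow> nat set \<Rightarrow> bit mat \<Rightarrow> bool" for M where
  loop_exit:
    "\<not> running M C V \<Longrightarrow> pess_loop M H C V (submatrix M C V)"
| loop_halt:
    "running M C V \<Longrightarrow> lightest_row H C c \<Longrightarrow> row_support H c = {}
     \<Longrightarrow> strip M (insert c C) V C' V' \<Longrightarrow> \<not> empty_sub C' V'
     \<Longrightarrow> pess_loop M H C V (submatrix M C' V')"
| loop_continue:
    "running M C V \<Longrightarrow> lightest_row H C c
     \<Longrightarrow> row_support H c \<noteq> {} \<or> (\<exists>C' V'. strip M (insert c C) V C' V' \<and> empty_sub C' V')
     \<Longrightarrow> pess_loop M (zero_cols H (row_support H c)) (insert c C) (V \<union> row_support H c) A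
     \<Longrightarrow> pess_loop M H C V A"

definition pess_finder_outputs :: "bit mat \<Rightarrow> bit mat \<Rightarrow> bool" where
  "pess_finder_outputs M A \<longleftrightarrow> pess_loop M M {} {} A"

end

theory Submission
  imports Defs
begin

text \<open>
  Take B blocks of 8 rows and 16 columns, every row having weight 3. Half of the rows are isolated:
  each is the only row meeting its three columns. The other 4 B rows form a square matrix whose
  columns L, P, U, V are indexed cyclically by i < B:
  a(i) meets L(i), L(i+1), P(i); q(i) meets P(i), U(i), U(i+1); p(i) meets L(i), U(i), V(i);
  s(i) meets P(i), V(i), V(i+1). On a kernel vector, U + V is constant in i by the rows q and s, so L
  is constant by p, P = 0 by a, and U and V are constant. The kernel of this square matrix is thus
  determined by U(0) and V(0); the isolated columns contribute 8 B more dimensions, which gives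
  8 B + 2 = n/2 + 2 in total.

  The algorithm can take the isolated rows first (weight 3), then a(0), a(1), ... (weight 2 after
  the first one, because of the shared column L(i+1)), then q(0), q(1), ... (weight 1 after the first one).
  The last q has weight 0. At that moment 6 B rows and 15 B columns are selected. The rows a(i) and q(i)
  together meet no selected column exactly once, so STRIP never removes them and returns a nonempty
  submatrix. STRIP preserves the difference between the numbers of columns and rows, so the kernel of
  the output has dimension at least 9 B = n/2 + n/16.
\<close>

section \<open>Bounds for kernel dimensions\<close>

text \<open>The kernel dimension is the number of columns minus the number of pivots of the echelon
  form, and there is at most one pivot per row.\<close>

lemma kernel_dim_ge:
  fixes A :: "'a :: field mat"
  shows "dim_col A - dim_row A \<le> kernel_dim A"
proof -
  define nr nc where "nr = dim_row A" and "nc = dim_col A"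
  define R where "R = gauss_jordan_single A"
  have A: "A \<in> carrier_mat nr nc"
    unfolding nr_def nc_def by auto
  have R: "R \<in> carrier_mat nr nc" "row_echelon_form R"
    using gauss_jordan_single(2,3)[OF A R_def[symmetric]] by auto
  have "length (pivot_positions R) = card {i. i < nr \<and> row R i \<noteq> 0\<^sub>v nc}"
    by (rule find_base_vectors(5)[OF R(2,1)])
  also have "\<dots> \<le> card {..<nr}"
    by (rule card_mono) auto
  finally have "length (pivot_positions R) \<le> nr"
    by simp
  then show ?thesis
    unfolding kernel_dim_code R_def[symmetric] nr_def nc_def by simp
qed

text \<open>Coordinates with respect to a basis identify the kernel with the functions from the
  basis to the field. Dimensions can then be compared by counting.\<close>

lemma card_mat_kernel:
  fixes A :: "'a :: field mat"
  assumes "finite (UNIV :: 'a set)"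
  shows "card (mat_kernel A) = card (UNIV :: 'a set) ^ kernel_dim A"
proof -
  interpret kernel "dim_row A" "dim_col A" A
    by unfold_locales auto
  have "v \<in> vec (dim_col A) ` ({..<dim_col A} \<rightarrow>\<^sub>E UNIV)" if "v \<in> carrier_vec (dim_col A)" for v :: "'a vec"
    using that by (intro image_eqI[of _ _ "restrict (($) v) {..<dim_col A}"]) auto
  moreover have "finite (vec (dim_col A) ` ({..<dim_col A} \<rightarrow>\<^sub>E (UNIV :: 'a set)))"
    using assms by (intro finite_imageI finite_PiE) auto
  ultimately have "finite (carrier_vec (dim_col A) :: 'a vec set)"
    by (metis finite_subset subsetI)
  then have fin: "finite (mat_kernel A)"
    by (rule finite_subset[OF mat_kernel_carrier[OF A]])
  \<comment> \<open>The kernel itself is a finite generating set.\<close>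
  have "Ker.fin_dim"
    unfolding Ker.fin_dim_def using fin Ker.span_is_subset2[of "mat_kernel A"] Ker.in_own_span[of "mat_kernel A"]
    by auto
  then obtain b where b: "finite b" "basis b"
    using Ker.finite_basis_exists by blast
  then have sub: "b \<subseteq> mat_kernel A"
    by (simp add: Ker.basis_def)
  have "bij_betw (\<lambda>a. lincomb a b) (b \<rightarrow>\<^sub>E UNIV) (mat_kernel A)"
  proof -
    have ex1: "\<exists>!a. a \<in> b \<rightarrow>\<^sub>E UNIV \<and> lincomb a b = v" if "v \<in> mat_kernel A" for v
      using Ker.basis_criterion[of b] b sub that by (auto simp: class_ring_simps)
    have mem: "lincomb a b \<in> mat_kernel A" for a
      using Ker.lincomb_closed[OF sub] by auto
    show ?thesis
      unfolding bij_betw_def inj_on_def using ex1 mem by blast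
  qed
  then have "card (mat_kernel A) = card (b \<rightarrow>\<^sub>E (UNIV :: 'a set))"
    by (simp add: bij_betw_same_card)
  also have "\<dots> = card (UNIV :: 'a set) ^ card b"
    using b by (simp add: card_PiE)
  also have "card b = kernel_dim A"
    using Ker.dim_basis[OF b] by simp
  finally show ?thesis .
qed

text \<open>Restriction to the coordinates in \<open>J\<close> is injective on the kernel: the
  difference of two vectors with equal restrictions vanishes on \<open>J\<close>. Counting the
  restrictions bounds the dimension.\<close>

lemma kernel_dim_le:
  fixes A :: "'a :: field mat"
  assumes UNIV: "finite (UNIV :: 'a set)"
    and "finite J"
    and zero: "\<And>v. v \<in> mat_kernel A \<Longrightarrow> (\<And>j. j \<in> J \<Longrightarrow> v $ j = 0) \<Longrightarrow> v = 0\<^sub>v (dim_col A)"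
    and J: "J \<subseteq> {..<dim_col A}"
  shows "kernel_dim A \<le> card J"
proof -
  let ?f = "\<lambda>v. restrict (($) v) J"
  have "inj_on ?f (mat_kernel A)"
  proof (rule inj_onI)
    fix v w assume v: "v \<in> mat_kernel A" and w: "w \<in> mat_kernel A" and eq: "?f v = ?f w"
    have c: "v \<in> carrier_vec (dim_col A)" "w \<in> carrier_vec (dim_col A)"
      using v w by (auto simp: mat_kernel_def)
    have "v - w \<in> mat_kernel A"
      using v w c by (auto simp: mat_kernel_def mult_minus_distrib_mat_vec[of A "dim_row A" "dim_col A"])
    moreover have "(v - w) $ j = 0" if "j \<in> J" for j
      using fun_cong[OF eq, of j] that J c by auto
    ultimately have "v - w = 0\<^sub>v (dim_col A)"
      by (rule zero)
    then show "v = w"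
      using c by (metis comm_add_vec minus_add_minus_vec minus_cancel_vec uminus_eq_vec zero_minus_vec)
  qed
  moreover have "?f ` mat_kernel A \<subseteq> J \<rightarrow>\<^sub>E UNIV"
    by auto
  ultimately have "card (mat_kernel A) \<le> card (J \<rightarrow>\<^sub>E (UNIV :: 'a set))"
    using \<open>finite J\<close> UNIV by (intro card_inj_on_le) (auto intro!: finite_PiE)
  also have "\<dots> = card (UNIV :: 'a set) ^ card J"
    using \<open>finite J\<close> by (simp add: card_PiE)
  finally have "card (UNIV :: 'a set) ^ kernel_dim A \<le> card (UNIV :: 'a set) ^ card J"
    using UNIV by (simp add: card_mat_kernel)
  \<comment> \<open>The base of the two powers exceeds 1, so the exponents compare.\<close>
  moreover have "card {0 :: 'a, 1} \<le> card (UNIV :: 'a set)"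
    using UNIV by (intro card_mono) auto
  ultimately show ?thesis
    by simp
qed

lemma finite_UNIV_bit: "finite (UNIV :: bit set)"
proof -
  have "x \<in> {0, 1}" for x :: bit
    by (cases x) simp_all
  then have "(UNIV :: bit set) \<subseteq> {0, 1}"
    by (rule subsetI)
  then show ?thesis
    by (rule finite_subset) simp
qed

section \<open>Properties of STRIP\<close>

text \<open>Each removal deletes exactly one row and one column, so \<open>card V - card C\<close>
  is invariant; the additive form avoids truncated subtraction.\<close>

lemma strip_invariants:
  assumes "strip M C V C' V'" "finite C" "finite V"
  shows "C' \<subseteq> C \<and> V' \<subseteq> V \<and> card V' + card C = card V + card C'"
  using assms
proof (induction rule: strip.induct)
  case (strip_remove x V C r C' V')
  have "r \<in> C"
    using strip_remove.hyps(2) by blast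
  then have "card C = Suc (card (C - {r}))" "card V = Suc (card (V - {x}))"
    using strip_remove.prems strip_remove.hyps(1) by (simp_all only: card.remove)
  then show ?case
    using strip_remove.IH strip_remove.prems by auto
qed simp

text \<open>If a removed row \<open>r\<close> were in \<open>S\<close>, its column would meet
  \<open>C\<close>, and hence \<open>S\<close>, in \<open>r\<close> alone. The argument applies to
  every removal order.\<close>

lemma strip_keeps_stopping_set:
  assumes "strip M C V C' V'" "S \<subseteq> C" "\<And>x. x \<in> V \<Longrightarrow> card (col_support M x \<inter> S) \<noteq> 1"
  shows "S \<subseteq> C'"
  using assms
proof (induction rule: strip.induct)
  case (strip_remove x V C r C' V')
  have "r \<notin> S"
  proof
    assume "r \<in> S"
    then have "col_support M x \<inter> S = {r}"
      using strip_remove.hyps(2) strip_remove.prems(1) by auto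
    then show False
      using strip_remove.prems(2)[OF strip_remove.hyps(1)] by simp
  qed
  then show ?case
    using strip_remove.IH strip_remove.prems by blast
qed simp

text \<open>Since \<open>strip\<close> is a relation, a result has to be exhibited before the loop
  can halt with it; every removal shrinks \<open>V\<close>.\<close>

lemma strip_terminates:
  assumes "finite V"
  shows "\<exists>C' V'. strip M C V C' V'"
  using assms
proof (induction "card V" arbitrary: C V)
  case 0
  then show ?case
    by (auto intro: strip_stop)
next
  case (Suc k)
  show ?case
  proof (cases "\<forall>x\<in>V. card (col_support M x \<inter> C) \<noteq> 1")
    case False
    then obtain x r where x: "x \<in> V" "col_support M x \<inter> C = {r}"
      by (auto simp: card_1_singleton_iff)
    moreover obtain C' V' where "strip M (C - {r}) (V - {x}) C' V'"
      using Suc.hyps(1)[of "V - {x}" "C - {r}"] Suc.hyps(2) Suc.prems x(1) by (metis card_Diff_singleton diff_Suc_1 finite_Diff)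
    ultimately show ?thesis
      by (blast intro: strip_remove)
  qed (blast intro: strip_stop)
qed

section \<open>Runs that select the rows in numerical order\<close>

lemma dim_row_zero_cols: "dim_row (zero_cols M V) = dim_row M"
  by (simp add: zero_cols_def)

lemma zero_cols_empty: "zero_cols M {} = M"
  by (rule eq_matI) (auto simp: zero_cols_def)

lemma zero_cols_zero_cols: "zero_cols (zero_cols H V) W = zero_cols H (V \<union> W)"
  by (rule eq_matI) (auto simp: zero_cols_def)

lemma row_support_zero_cols:
  "i < dim_row M \<Longrightarrow> row_support (zero_cols M V) i = row_support M i - V"
  by (auto simp: row_support_def zero_cols_def split: if_splits)

text \<open>This is the set V of the algorithm after the rows below \<open>t\<close> have been
  taken; the current matrix H is then \<open>zero_cols M (prefix_cols M t)\<close>.\<close>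

definition prefix_cols :: "bit mat \<Rightarrow> nat \<Rightarrow> nat set" where
  "prefix_cols M t = (\<Union>r<t. row_support M r)"

lemma prefix_cols_Suc: "prefix_cols M (Suc t) = prefix_cols M t \<union> row_support M t"
  by (auto simp: prefix_cols_def less_Suc_eq)

lemma prefix_cols_subset: "prefix_cols M t \<subseteq> {0..<dim_col M}"
  by (auto simp: prefix_cols_def row_support_def)

lemma lightest_row_prefix:
  assumes "t < dim_row M"
    and "\<And>r. t < r \<Longrightarrow> r < dim_row M \<Longrightarrow>
      card (row_support M t - prefix_cols M t) \<le> card (row_support M r - prefix_cols M t)"
  shows "lightest_row (zero_cols M (prefix_cols M t)) {0..<t} t"
  unfolding lightest_row_def row_weight_def dim_row_zero_cols
proof (intro conjI allI impI)
  fix r assume r: "r < dim_row M \<and> r \<notin> {0..<t}"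
  show "card (row_support (zero_cols M (prefix_cols M t)) t)
      \<le> card (row_support (zero_cols M (prefix_cols M t)) r)"
  proof (cases "r = t")
    case False
    then have "t < r"
      using r by simp
    then show ?thesis
      using assms r by (simp add: row_support_zero_cols)
  qed simp
qed (use assms(1) in auto)

text \<open>Every row before \<open>k\<close> brings a new column, so the test in step (b) first
  applies at row \<open>k\<close>, where the loop halts.\<close>

lemma pess_finder_prefix_run:
  assumes k: "k < dim_row M"
    and V: "prefix_cols M k \<noteq> {0..<dim_col M}"
    and light: "\<And>t r. t \<le> k \<Longrightarrow> t < r \<Longrightarrow> r < dim_row M \<Longrightarrow>
      card (row_support M t - prefix_cols M t) \<le> card (row_support M r - prefix_cols M t)"
    and new: "\<And>t. t < k \<Longrightarrow> \<not> row_support M t \<subseteq> prefix_cols M t"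
    and old: "row_support M k \<subseteq> prefix_cols M k"
    and strip: "strip M {0..k} (prefix_cols M k) C' V'" "\<not> empty_sub C' V'"
  shows "pess_finder_outputs M (submatrix M C' V')"
proof -
  have run: "running M {0..<t} (prefix_cols M t)" if "t \<le> k" for t
  proof -
    have "prefix_cols M t \<subseteq> prefix_cols M k"
      unfolding prefix_cols_def using that by (intro UN_mono) auto
    then have "prefix_cols M t \<noteq> {0..<dim_col M}"
      using V prefix_cols_subset[of M k] by auto
    moreover have "{0..<t} \<noteq> {0..<dim_row M}"
      using that k by (metis atLeastLessThan_iff less_irrefl not_le zero_le)
    ultimately show ?thesis
      by (simp add: running_def)
  qed
  have "pess_loop M (zero_cols M (prefix_cols M t)) {0..<t} (prefix_cols M t) (submatrix M C' V')"
    if "t \<le> k" for t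
    using that
  \<comment> \<open>The induction descends from \<open>k\<close> to 0, because
    \<open>loop_continue\<close> derives the output of a state from that of its successor.\<close>
  proof (induction rule: inc_induct)
    case base
    show ?case
    proof (rule loop_halt[OF run lightest_row_prefix])
      show "row_support (zero_cols M (prefix_cols M k)) k = {}"
        using k old by (simp add: row_support_zero_cols)
      show "strip M (insert k {0..<k}) (prefix_cols M k) C' V'"
        using strip(1) by (simp add: atLeast0AtMost atLeast0LessThan lessThan_Suc_atMost[symmetric] lessThan_Suc)
    qed (use k light strip(2) in auto)
  next
    case (step t)
    let ?W = "row_support (zero_cols M (prefix_cols M t)) t"
    have W: "?W = row_support M t - prefix_cols M t"
      using step.hyps k by (simp add: row_support_zero_cols)
    have ins: "insert t {0..<t} = {0..<Suc t}"
      by auto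
    have un: "prefix_cols M t \<union> ?W = prefix_cols M (Suc t)"
      by (simp add: W prefix_cols_Suc)
    show ?case
    proof (rule loop_continue[OF run lightest_row_prefix])
      show "?W \<noteq> {} \<or> (\<exists>C' V'. strip M (insert t {0..<t}) (prefix_cols M t) C' V' \<and> empty_sub C' V')"
        using new[OF step.hyps(2)] W by blast
      show "pess_loop M (zero_cols (zero_cols M (prefix_cols M t)) ?W) (insert t {0..<t})
          (prefix_cols M t \<union> ?W) (submatrix M C' V')"
        unfolding zero_cols_zero_cols ins un by (rule step.IH)
    qed (use step.hyps k light in auto)
  qed
  from this[of 0] show ?thesis
    by (simp add: pess_finder_outputs_def prefix_cols_def zero_cols_empty)
qed

text \<open>The stopping set \<open>S\<close> survives STRIP, so rows remain; as the selected
  columns are at least as many as the \<open>Suc k\<close> selected rows, columns remain too. The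
  preserved excess of columns over rows bounds the kernel dimension from below.\<close>

lemma pess_finder_prefix_output:
  assumes k: "k < dim_row M"
    and V: "prefix_cols M k \<noteq> {0..<dim_col M}"
    and light: "\<And>t r. t \<le> k \<Longrightarrow> t < r \<Longrightarrow> r < dim_row M \<Longrightarrow>
      card (row_support M t - prefix_cols M t) \<le> card (row_support M r - prefix_cols M t)"
    and new: "\<And>t. t < k \<Longrightarrow> \<not> row_support M t \<subseteq> prefix_cols M t"
    and old: "row_support M k \<subseteq> prefix_cols M k"
    and S: "S \<noteq> {}" "S \<subseteq> {0..k}" "\<And>x. x \<in> prefix_cols M k \<Longrightarrow> card (col_support M x \<inter> S) \<noteq> 1"
    and more_cols: "k < card (prefix_cols M k)"
  shows "\<exists>A. is_submatrix A M \<and> pess_finder_outputs M A \<and> card (prefix_cols M k) \<le> kernel_dim A + Suc k"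
proof -
  have fin: "finite (prefix_cols M k)"
    using prefix_cols_subset by (rule finite_subset) simp
  obtain C' V' where strip: "strip M {0..k} (prefix_cols M k) C' V'"
    using strip_terminates[OF fin] by blast
  have inv: "C' \<subseteq> {0..k}" "V' \<subseteq> prefix_cols M k" "card V' + Suc k = card (prefix_cols M k) + card C'"
    using strip_invariants[OF strip] fin by auto
  have "S \<subseteq> C'"
    using strip S(2,3) by (rule strip_keeps_stopping_set)
  then have "C' \<noteq> {}"
    using S(1) by auto
  moreover have "finite C'"
    using inv(1) by (rule finite_subset) simp
  ultimately have "0 < card C'"
    by (simp add: card_gt_0_iff)
  then have "V' \<noteq> {}"
    using inv(3) more_cols by auto
  with \<open>C' \<noteq> {}\<close> have "\<not> empty_sub C' V'"
    by (simp add: empty_sub_def)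
  then have out: "pess_finder_outputs M (submatrix M C' V')"
    using k V light new old strip by (intro pess_finder_prefix_run)
  have sub: "C' \<subseteq> {0..<dim_row M}" "V' \<subseteq> {0..<dim_col M}"
    using inv(1,2) k prefix_cols_subset[of M k] by auto
  then have "{i. i < dim_row M \<and> i \<in> C'} = C'" "{j. j < dim_col M \<and> j \<in> V'} = V'"
    by auto
  then have "card V' - card C' \<le> kernel_dim (submatrix M C' V')"
    using kernel_dim_ge[of "submatrix M C' V'"] by (simp add: dim_submatrix)
  then have "card (prefix_cols M k) \<le> kernel_dim (submatrix M C' V') + Suc k"
    using inv(3) by linarith
  then show ?thesis
    using out sub unfolding is_submatrix_def by blast
qed

section \<open>The matrix and its column weights\<close>

definition succ_mod :: "nat \<Rightarrow> nat \<Rightarrow> nat" where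
  "succ_mod B i = (if Suc i = B then 0 else Suc i)"

text \<open>This names the row that reaches a given column as its cyclic successor.\<close>

definition pred_mod :: "nat \<Rightarrow> nat \<Rightarrow> nat" where
  "pred_mod B i = (if i = 0 then B - 1 else i - 1)"

text \<open>
  The rows are, in this order, the isolated rows and the a, q, p and s rows, so that the algorithm
  may select the rows 0, 1, 2, ... in their numerical order. The isolated columns come first,
  followed by L, P, U and V.
\<close>

definition row_cols :: "nat \<Rightarrow> nat \<Rightarrow> nat set" where
  "row_cols B r =
    (if r < 4 * B then {3 * r, 3 * r + 1, 3 * r + 2}
     else if r < 5 * B then {12 * B + (r - 4 * B), 12 * B + succ_mod B (r - 4 * B), 13 * B + (r - 4 * B)}
     else if r < 6 * B then {13 * B + (r - 5 * B), 14 * B + (r - 5 * B), 14 * B + succ_mod B (r - 5 * B)}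
     else if r < 7 * B then {12 * B + (r - 6 * B), 14 * B + (r - 6 * B), 15 * B + (r - 6 * B)}
     else {13 * B + (r - 7 * B), 15 * B + (r - 7 * B), 15 * B + succ_mod B (r - 7 * B)})"

definition ladder_mat :: "nat \<Rightarrow> bit mat" where
  "ladder_mat B = mat (8 * B) (16 * B) (\<lambda>(r, j). if j \<in> row_cols B r then 1 else 0)"

lemma ladder_mat_carrier: "ladder_mat B \<in> carrier_mat (8 * B) (16 * B)"
  by (simp add: ladder_mat_def)

lemma dim_ladder_mat [simp]: "dim_row (ladder_mat B) = 8 * B" "dim_col (ladder_mat B) = 16 * B"
  by (simp_all add: ladder_mat_def)

lemma row_cols_simps:
  assumes "i < B"
  shows "row_cols B (4 * B + i) = {12 * B + i, 12 * B + succ_mod B i, 13 * B + i}"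
    and "row_cols B (5 * B + i) = {13 * B + i, 14 * B + i, 14 * B + succ_mod B i}"
    and "row_cols B (6 * B + i) = {12 * B + i, 14 * B + i, 15 * B + i}"
    and "row_cols B (7 * B + i) = {13 * B + i, 15 * B + i, 15 * B + succ_mod B i}"
  using assms by (simp_all add: row_cols_def)

lemma row_cases:
  fixes B :: nat
  assumes "r < 8 * B"
  obtains "r < 4 * B"
  | i where "i < B" "r = 4 * B + i"
  | i where "i < B" "r = 5 * B + i"
  | i where "i < B" "r = 6 * B + i"
  | i where "i < B" "r = 7 * B + i"
proof -
  consider "r < 4 * B" | "4 * B \<le> r" "r < 5 * B" | "5 * B \<le> r" "r < 6 * B"
    | "6 * B \<le> r" "r < 7 * B" | "7 * B \<le> r"
    by linarith
  then show thesis
    using that(1) that(2)[of "r - 4 * B"] that(3)[of "r - 5 * B"] that(4)[of "r - 6 * B"]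
      that(5)[of "r - 7 * B"] assms by cases auto
qed

lemma succ_mod_less: "i < B \<Longrightarrow> succ_mod B i < B"
  by (auto simp: succ_mod_def)

lemma pred_mod_less: "i < B \<Longrightarrow> pred_mod B i < B"
  by (auto simp: pred_mod_def)

lemma succ_pred_mod: "i < B \<Longrightarrow> succ_mod B (pred_mod B i) = i"
  by (auto simp: succ_mod_def pred_mod_def)

lemma pred_succ_mod: "i < B \<Longrightarrow> pred_mod B (succ_mod B i) = i"
  by (auto simp: succ_mod_def pred_mod_def)

lemma succ_mod_neq: "2 \<le> B \<Longrightarrow> succ_mod B i \<noteq> i"
  by (auto simp: succ_mod_def)

lemma pred_mod_neq: "2 \<le> B \<Longrightarrow> pred_mod B i \<noteq> i"
  by (auto simp: pred_mod_def)

lemma row_cols_less: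
  assumes "r < 8 * B"
  shows "row_cols B r \<subseteq> {..<16 * B}"
  using assms
  by (rule row_cases) (use assms in \<open>auto simp: row_cols_simps row_cols_def[of B r] dest: succ_mod_less\<close>)

lemma row_support_ladder_mat:
  assumes "r < 8 * B"
  shows "row_support (ladder_mat B) r = row_cols B r"
  using row_cols_less[OF assms] assms by (auto simp: row_support_def ladder_mat_def split: if_splits)

lemma col_support_ladder_mat:
  assumes "x < 16 * B"
  shows "col_support (ladder_mat B) x = {r. r < 8 * B \<and> x \<in> row_cols B r}"
  using assms by (auto simp: col_support_def ladder_mat_def split: if_splits)

lemma card_le_3: "A \<subseteq> {a, b, c} \<Longrightarrow> card A \<le> 3"
  by (rule order.trans[OF card_mono]) (auto simp: card_insert_if)

text \<open>An isolated column lies only in row \<open>x div 3\<close>. Otherwise L(i) lies in a(i),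
  a(i-1), p(i); P(i) in a(i), q(i), s(i); U(i) in q(i), q(i-1), p(i); V(i) in p(i), s(i),
  s(i-1).\<close>

lemma col_weight_ladder_mat:
  assumes "x < 16 * B"
  shows "col_weight (ladder_mat B) x \<le> 3"
proof -
  consider "x < 12 * B" | i where "i < B" "x = 12 * B + i" | i where "i < B" "x = 13 * B + i"
    | i where "i < B" "x = 14 * B + i" | i where "i < B" "x = 15 * B + i"
  proof -
    consider "x < 12 * B" | "12 * B \<le> x" "x < 13 * B" | "13 * B \<le> x" "x < 14 * B"
      | "14 * B \<le> x" "x < 15 * B" | "15 * B \<le> x"
      by linarith
    then show thesis
      using that(1) that(2)[of "x - 12 * B"] that(3)[of "x - 13 * B"] that(4)[of "x - 14 * B"]
        that(5)[of "x - 15 * B"] assms by cases auto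
  qed
  then have "\<exists>a b c. {r. r < 8 * B \<and> x \<in> row_cols B r} \<subseteq> {a, b, c}"
  proof cases
    case 1
    have "{r. r < 8 * B \<and> x \<in> row_cols B r} \<subseteq> {x div 3, x div 3, x div 3}"
      using 1 by (auto simp: row_cols_def split: if_splits)
    then show ?thesis by blast
  next
    case (2 i)
    have "r \<in> {4 * B + i, 4 * B + pred_mod B i, 6 * B + i}" if "r < 8 * B" "x \<in> row_cols B r" for r
      using that(1)
      by (rule row_cases) (use that 2 in \<open>auto simp: row_cols_simps row_cols_def[of B r] dest: succ_mod_less simp: pred_succ_mod\<close>)
    then show ?thesis by blast
  next
    case (3 i)
    have "r \<in> {4 * B + i, 5 * B + i, 7 * B + i}" if "r < 8 * B" "x \<in> row_cols B r" for r
      using that(1)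
      by (rule row_cases) (use that 3 in \<open>auto simp: row_cols_simps row_cols_def[of B r] dest: succ_mod_less simp: pred_succ_mod\<close>)
    then show ?thesis by blast
  next
    case (4 i)
    have "r \<in> {5 * B + i, 5 * B + pred_mod B i, 6 * B + i}" if "r < 8 * B" "x \<in> row_cols B r" for r
      using that(1)
      by (rule row_cases) (use that 4 in \<open>auto simp: row_cols_simps row_cols_def[of B r] dest: succ_mod_less simp: pred_succ_mod\<close>)
    then show ?thesis by blast
  next
    case (5 i)
    have "r \<in> {6 * B + i, 7 * B + i, 7 * B + pred_mod B i}" if "r < 8 * B" "x \<in> row_cols B r" for r
      using that(1)
      by (rule row_cases) (use that 5 in \<open>auto simp: row_cols_simps row_cols_def[of B r] dest: succ_mod_less simp: pred_succ_mod\<close>)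
    then show ?thesis by blast
  qed
  then obtain a b c where "{r. r < 8 * B \<and> x \<in> row_cols B r} \<subseteq> {a, b, c}"
    by blast
  then show ?thesis
    unfolding col_weight_def col_support_ladder_mat[OF assms] by (rule card_le_3)
qed

section \<open>The kernel of the matrix\<close>

lemma kernel_dim_ladder_mat:
  assumes "2 \<le> B"
  shows "kernel_dim (ladder_mat B) \<le> 8 * B + 2"
proof -
  \<comment> \<open>The determining coordinates are two of the three columns of each isolated row,
    together with U(0) and V(0).\<close>
  define J where "J = (\<lambda>r. 3 * r) ` {..<4 * B} \<union> (\<lambda>r. 3 * r + 1) ` {..<4 * B} \<union> {14 * B, 15 * B}"
  have fin: "finite J"
    unfolding J_def by simp
  have "card J \<le> card ((\<lambda>r. 3 * r) ` {..<4 * B}) + card ((\<lambda>r. 3 * r + 1) ` {..<4 * B}) + card {14 * B, 15 * B}"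
    unfolding J_def by (intro order.trans[OF card_Un_le] add_mono order.refl)
  also have "\<dots> \<le> 4 * B + 4 * B + 2"
    using card_image_le[of "{..<4 * B}"] by (intro add_mono) (auto simp: card_insert_if)
  finally have J: "card J \<le> 8 * B + 2"
    by simp
  have "v = 0\<^sub>v (dim_col (ladder_mat B))"
    if v: "v \<in> mat_kernel (ladder_mat B)" and zero: "\<And>j. j \<in> J \<Longrightarrow> v $ j = 0" for v
  proof -
    have carr: "v \<in> carrier_vec (16 * B)" and Mv: "ladder_mat B *\<^sub>v v = 0\<^sub>v (8 * B)"
      using mat_kernelD[OF ladder_mat_carrier v] by auto
    have sum0: "(\<Sum>j\<in>row_cols B r. v $ j) = 0" if r: "r < 8 * B" for r
    proof -
      have "0 = (ladder_mat B *\<^sub>v v) $ r"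
        using r by (simp add: Mv)
      also have "\<dots> = (\<Sum>j<16 * B. (if j \<in> row_cols B r then 1 else 0) * v $ j)"
        using r carr by (auto simp: scalar_prod_def ladder_mat_def atLeast0LessThan intro!: sum.cong)
      also have "\<dots> = (\<Sum>j<16 * B. if j \<in> row_cols B r then v $ j else 0)"
        by (intro sum.cong refl) simp
      also have "\<dots> = (\<Sum>j\<in>{..<16 * B} \<inter> row_cols B r. v $ j)"
        by (subst sum.inter_restrict) simp_all
      also have "{..<16 * B} \<inter> row_cols B r = row_cols B r"
        using row_cols_less[OF r] by auto
      finally show ?thesis by simp
    qed
    have D: "v $ j = 0" if j: "j < 12 * B" for j
    proof -
      have r: "j div 3 < 4 * B"
        using j by linarith
      have "v $ (3 * (j div 3)) = 0" "v $ (3 * (j div 3) + 1) = 0"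
        using zero r by (auto simp: J_def)
      moreover from this have "v $ (3 * (j div 3) + 2) = 0"
        using sum0[of "j div 3"] r by (simp add: row_cols_def)
      moreover have "j = 3 * (j div 3) \<or> j = 3 * (j div 3) + 1 \<or> j = 3 * (j div 3) + 2"
        by presburger
      ultimately show ?thesis by metis
    qed
    \<comment> \<open>The columns must be distinct, since a sum over the set would count coinciding
      ones only once.\<close>
    have sum3: "v $ a + v $ b + v $ c = 0"
      if "row_cols B r = {a, b, c}" "r < 8 * B" "a \<noteq> b" "a \<noteq> c" "b \<noteq> c" for r a b c
    proof -
      have "sum (($) v) {a, b, c} = v $ a + v $ b + v $ c"
        using that(3-5) by (simp only: sum.insert finite.intros insert_iff empty_iff sum.empty
            add.assoc add_0_right simp_thms)
      then show ?thesis
        using sum0[OF that(2)] that(1) by simp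
    qed
    \<comment> \<open>The rows q(i) and s(i) share P(i), so equality of U and V passes from i to
      i+1.\<close>
    have UV: "v $ (14 * B + i) = v $ (15 * B + i)" if "i < B" for i
      using that
    proof (induction i)
      case 0
      then show ?case
        using zero by (simp add: J_def)
    next
      case (Suc i)
      have "v $ (13 * B + i) + v $ (14 * B + i) + v $ (14 * B + Suc i) = 0"
        using Suc.prems by (intro sum3[of "5 * B + i"]) (auto simp: row_cols_simps succ_mod_def)
      moreover have "v $ (13 * B + i) + v $ (15 * B + i) + v $ (15 * B + Suc i) = 0"
        using Suc.prems by (intro sum3[of "7 * B + i"]) (auto simp: row_cols_simps succ_mod_def)
      moreover have "v $ (14 * B + i) = v $ (15 * B + i)"
        using Suc by simp
      ultimately show ?case
        by (metis add_left_cancel)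
    qed
    \<comment> \<open>In row p(i) the equal entries U(i) and V(i) cancel in characteristic
      2.\<close>
    have L: "v $ (12 * B + i) = 0" if "i < B" for i
    proof -
      have "v $ (12 * B + i) + v $ (14 * B + i) + v $ (15 * B + i) = 0"
        using that by (intro sum3[of "6 * B + i"]) (auto simp: row_cols_simps)
      then show ?thesis
        unfolding UV[OF that] by (cases "v $ (12 * B + i)"; cases "v $ (15 * B + i)") simp_all
    qed
    \<comment> \<open>Row a(i) expresses P(i) by two entries of L; these are different columns
      because \<open>2 \<le> B\<close>.\<close>
    have P: "v $ (13 * B + i) = 0" if "i < B" for i
    proof -
      have "v $ (12 * B + i) + v $ (12 * B + succ_mod B i) + v $ (13 * B + i) = 0"
        using that succ_mod_less[OF that] succ_mod_neq[OF assms, of i]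
        by (intro sum3[of "4 * B + i"]) (auto simp: row_cols_simps)
      then show ?thesis
        by (simp add: L that succ_mod_less)
    qed
    \<comment> \<open>With P zero, row q(i) carries the value U(0) = 0 along the block.\<close>
    have U: "v $ (14 * B + i) = 0" if "i < B" for i
      using that
    proof (induction i)
      case 0
      then show ?case
        using zero by (simp add: J_def)
    next
      case (Suc i)
      have "v $ (13 * B + i) + v $ (14 * B + i) + v $ (14 * B + Suc i) = 0"
        using Suc.prems by (intro sum3[of "5 * B + i"]) (auto simp: row_cols_simps succ_mod_def)
      then show ?case
        using Suc P[of i] by simp
    qed
    show ?thesis
    proof (rule eq_vecI)
      fix j assume "j < dim_vec (0\<^sub>v (dim_col (ladder_mat B)))"
      then consider "j < 12 * B" | "12 * B \<le> j" "j < 13 * B" | "13 * B \<le> j" "j < 14 * B"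
        | "14 * B \<le> j" "j < 15 * B" | "15 * B \<le> j" "j < 16 * B"
        by fastforce
      then have "v $ j = 0"
        using D L[of "j - 12 * B"] P[of "j - 13 * B"] U[of "j - 14 * B"]
          UV[of "j - 15 * B"] U[of "j - 15 * B"]
        by cases auto
      then show "v $ j = 0\<^sub>v (dim_col (ladder_mat B)) $ j"
        using \<open>j < dim_vec _\<close> by simp
    qed (use carr in simp)
  qed
  then have "kernel_dim (ladder_mat B) \<le> card J"
    using fin assms by (intro kernel_dim_le finite_UNIV_bit) (auto simp: J_def)
  with J show ?thesis by simp
qed

section \<open>Columns selected along the run\<close>

lemma prefix_cols_triples:
  assumes "t \<le> 4 * B"
  shows "prefix_cols (ladder_mat B) t = {..<3 * t}"
  using assms
proof (induction t)
  case 0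
  then show ?case
    by (simp add: prefix_cols_def)
next
  case (Suc t)
  then have "prefix_cols (ladder_mat B) (Suc t) = {..<3 * t} \<union> row_cols B t"
    by (simp add: prefix_cols_Suc row_support_ladder_mat)
  also have "\<dots> = {..<3 * Suc t}"
    using Suc.prems by (auto simp: row_cols_def)
  finally show ?case .
qed

text \<open>Row a(0) adds L(0), L(1) and P(0); each later a(i) finds L(i) present and adds L(i+1)
  and P(i). The L block thus stays one column ahead of the P block until the cycle closes.\<close>

lemma prefix_cols_links:
  assumes "Suc i < B"
  shows "prefix_cols (ladder_mat B) (4 * B + Suc i) = {..12 * B + Suc i} \<union> {13 * B..13 * B + i}"
  using assms
proof (induction i)
  case 0
  have "prefix_cols (ladder_mat B) (4 * B + Suc 0) = {..<12 * B} \<union> row_cols B (4 * B + 0)"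
    using 0 by (simp add: prefix_cols_Suc prefix_cols_triples row_support_ladder_mat)
  also have "row_cols B (4 * B + 0) = {12 * B, 12 * B + Suc 0, 13 * B}"
    using 0 by (subst row_cols_simps) (simp_all add: succ_mod_def)
  also have "{..<12 * B} \<union> \<dots> = {..12 * B + Suc 0} \<union> {13 * B..13 * B + 0}"
    by auto
  finally show ?case .
next
  case (Suc i)
  have "prefix_cols (ladder_mat B) (4 * B + Suc (Suc i)) =
      prefix_cols (ladder_mat B) (4 * B + Suc i) \<union> row_cols B (4 * B + Suc i)"
    using Suc.prems by (simp add: prefix_cols_Suc row_support_ladder_mat)
  also have "row_cols B (4 * B + Suc i) = {12 * B + Suc i, 12 * B + Suc (Suc i), 13 * B + Suc i}"
    using Suc.prems by (subst row_cols_simps) (simp_all add: succ_mod_def)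
  also have "prefix_cols (ladder_mat B) (4 * B + Suc i) = {..12 * B + Suc i} \<union> {13 * B..13 * B + i}"
    using Suc by simp
  also have "\<dots> \<union> {12 * B + Suc i, 12 * B + Suc (Suc i), 13 * B + Suc i} =
      {..12 * B + Suc (Suc i)} \<union> {13 * B..13 * B + Suc i}"
    by auto
  finally show ?case .
qed

text \<open>The last a row wraps around to L(0), so P(B-1) is the only column it adds.\<close>

lemma prefix_cols_all_links:
  assumes "2 \<le> B"
  shows "prefix_cols (ladder_mat B) (5 * B) = {..<14 * B}"
proof -
  obtain i where i: "B = Suc (Suc i)"
    using assms by (metis add_2_eq_Suc le_Suc_ex)
  have "prefix_cols (ladder_mat B) (5 * B) = prefix_cols (ladder_mat B) (Suc (4 * B + Suc i))"
    using i by simp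
  also have "\<dots> = prefix_cols (ladder_mat B) (4 * B + Suc i) \<union> row_cols B (4 * B + Suc i)"
    unfolding prefix_cols_Suc using i by (subst row_support_ladder_mat) simp_all
  also have "row_cols B (4 * B + Suc i) = {12 * B + Suc i, 12 * B, 13 * B + Suc i}"
    using i by (subst row_cols_simps) (simp_all add: succ_mod_def)
  also have "prefix_cols (ladder_mat B) (4 * B + Suc i) = {..12 * B + Suc i} \<union> {13 * B..13 * B + i}"
    using i by (intro prefix_cols_links) simp
  also have "{..12 * B + Suc i} = {..<13 * B}"
    using i by auto
  also have "{..<13 * B} \<union> {13 * B..13 * B + i} \<union> {12 * B + Suc i, 12 * B, 13 * B + Suc i} = {..<14 * B}"
    using i by auto
  finally show ?thesis .
qed

text \<open>All of P is already selected: q(0) adds U(0) and U(1), and each later q(i) adds U(i+1)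
  only.\<close>

lemma prefix_cols_rails:
  assumes "Suc i < B"
  shows "prefix_cols (ladder_mat B) (5 * B + Suc i) = {..14 * B + Suc i}"
  using assms
proof (induction i)
  case 0
  have "prefix_cols (ladder_mat B) (5 * B + Suc 0) = {..<14 * B} \<union> row_cols B (5 * B + 0)"
    using 0 by (simp add: prefix_cols_Suc prefix_cols_all_links row_support_ladder_mat)
  also have "row_cols B (5 * B + 0) = {13 * B, 14 * B, 14 * B + Suc 0}"
    using 0 by (subst row_cols_simps) (simp_all add: succ_mod_def)
  also have "{..<14 * B} \<union> \<dots> = {..14 * B + Suc 0}"
    using 0 by auto
  finally show ?case .
next
  case (Suc i)
  have "prefix_cols (ladder_mat B) (5 * B + Suc (Suc i)) =
      prefix_cols (ladder_mat B) (5 * B + Suc i) \<union> row_cols B (5 * B + Suc i)"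
    using Suc.prems by (simp add: prefix_cols_Suc row_support_ladder_mat)
  also have "row_cols B (5 * B + Suc i) = {13 * B + Suc i, 14 * B + Suc i, 14 * B + Suc (Suc i)}"
    using Suc.prems by (subst row_cols_simps) (simp_all add: succ_mod_def)
  also have "prefix_cols (ladder_mat B) (5 * B + Suc i) = {..14 * B + Suc i}"
    using Suc by simp
  also have "\<dots> \<union> {13 * B + Suc i, 14 * B + Suc i, 14 * B + Suc (Suc i)} = {..14 * B + Suc (Suc i)}"
    using Suc.prems by auto
  finally show ?case .
qed

section \<open>Lightest rows, new columns and the stopping set\<close>

lemma finite_row_cols: "finite (row_cols B r)"
  by (simp add: row_cols_def)

lemma card_row_cols:
  assumes "2 \<le> B" "r < 8 * B"
  shows "card (row_cols B r) = 3"
proof -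
  show ?thesis
    using assms(2)
  proof (rule row_cases)
    assume "r < 4 * B"
    then show ?thesis by (simp add: row_cols_def)
  qed (use assms(1) in \<open>auto simp: row_cols_simps succ_mod_def card_insert_if\<close>)
qed

lemma two_le_card_row_cols_Diff:
  assumes "x \<in> row_cols B r" "y \<in> row_cols B r" "x \<noteq> y" "x \<notin> T" "y \<notin> T"
  shows "2 \<le> card (row_cols B r - T)"
  using card_mono[of "row_cols B r - T" "{x, y}"] assms by (simp add: finite_row_cols)

text \<open>The weight of the selected row is at most 3 up to a(0), at most 2 for the other a rows
  and for q(0), and at most 1 afterwards. In each phase, every later row keeps at least that many
  unselected columns.\<close>

lemma ladder_mat_lightest:
  assumes B: "2 \<le> B" and t: "t < 6 * B" and r: "t < r" "r < 8 * B"
  shows "card (row_cols B t - prefix_cols (ladder_mat B) t) \<le> card (row_cols B r - prefix_cols (ladder_mat B) t)"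
    (is "card (?X t) \<le> card (?X r)")
proof -
  have succ: "succ_mod B i < B" "succ_mod B i \<noteq> i" if "i < B" for i
    using succ_mod_less[OF that] succ_mod_neq[OF B, of i] by auto
  \<comment> \<open>The first row of each cycle has no selected predecessor in it, so a(0) joins the
    isolated rows and q(0) forms a case of its own.\<close>
  consider "t \<le> 4 * B" | i where "Suc i < B" "t = 4 * B + Suc i" | "t = 5 * B"
    | i where "Suc i < B" "t = 5 * B + Suc i"
  proof -
    consider "t \<le> 4 * B" | "4 * B < t" "t < 5 * B" | "t = 5 * B" | "5 * B < t"
      by linarith
    then show thesis
      using that(1) that(2)[of "t - 4 * B - 1"] that(3) that(4)[of "t - 5 * B - 1"] t
      by cases auto
  qed
  then show ?thesis
  proof cases
    case 1
    have "row_cols B r \<inter> prefix_cols (ladder_mat B) t = {}"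
      unfolding prefix_cols_triples[OF 1] using r(2)
      by (rule row_cases) (use 1 r in \<open>auto simp: row_cols_simps row_cols_def[of B r]\<close>)
    then have "card (?X r) = 3"
      using card_row_cols[OF B r(2)] by (simp add: Diff_triv)
    moreover have "card (?X t) \<le> 3"
      using card_row_cols[OF B, of t] t card_mono[OF finite_row_cols[of B t] Diff_subset] by auto
    ultimately show ?thesis by simp
  next
    case (2 i)
    have T: "prefix_cols (ladder_mat B) t =
        {..12 * B + Suc i} \<union> {13 * B..13 * B + i}"
      unfolding 2 using 2 by (intro prefix_cols_links) simp
    have "?X t \<subseteq> {12 * B + succ_mod B (Suc i), 13 * B + Suc i}"
      unfolding T unfolding 2(2) row_cols_simps(1)[OF 2(1)] using 2 by auto
    then have "card (?X t) \<le> 2"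
      by (rule order.trans[OF card_mono, rotated]) (auto simp: card_insert_if)
    also have "2 \<le> card (?X r)"
      using r(2)
    proof (rule row_cases)
      assume "r < 4 * B" then show ?thesis using r 2 by simp
    next
      fix k assume k: "k < B" "r = 4 * B + k"
      show ?thesis
        unfolding T using k r 2
        by (intro two_le_card_row_cols_Diff[of "12 * B + k" _ _ "13 * B + k"]) (auto simp: row_cols_simps)
    next
      fix k assume k: "k < B" "r = 5 * B + k"
      show ?thesis
        unfolding T using k succ[of k] r 2
        by (intro two_le_card_row_cols_Diff[of "14 * B + k" _ _ "14 * B + succ_mod B k"]) (auto simp: row_cols_simps)
    next
      fix k assume k: "k < B" "r = 6 * B + k"
      show ?thesis
        unfolding T using k r 2
        by (intro two_le_card_row_cols_Diff[of "14 * B + k" _ _ "15 * B + k"]) (auto simp: row_cols_simps)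
    next
      fix k assume k: "k < B" "r = 7 * B + k"
      show ?thesis
        unfolding T using k succ[of k] r 2
        by (intro two_le_card_row_cols_Diff[of "15 * B + k" _ _ "15 * B + succ_mod B k"]) (auto simp: row_cols_simps)
    qed
    finally show ?thesis .
  next
    case 3
    have T: "prefix_cols (ladder_mat B) t = {..<14 * B}"
      unfolding 3 by (rule prefix_cols_all_links[OF B])
    have "?X t \<subseteq> {14 * B, 14 * B + succ_mod B 0}"
      unfolding T unfolding 3 using row_cols_simps(2)[of 0 B] B by auto
    then have "card (?X t) \<le> 2"
      by (rule order.trans[OF card_mono, rotated]) (auto simp: card_insert_if)
    also have "2 \<le> card (?X r)"
      using r(2)
    proof (rule row_cases)
      assume "r < 4 * B" then show ?thesis using r 3 by simp
    next
      fix k assume "k < B" "r = 4 * B + k" then show ?thesis using r 3 by simp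
    next
      fix k assume k: "k < B" "r = 5 * B + k"
      show ?thesis
        unfolding T using k succ[of k]
        by (intro two_le_card_row_cols_Diff[of "14 * B + k" _ _ "14 * B + succ_mod B k"]) (auto simp: row_cols_simps)
    next
      fix k assume k: "k < B" "r = 6 * B + k"
      show ?thesis
        unfolding T using k
        by (intro two_le_card_row_cols_Diff[of "14 * B + k" _ _ "15 * B + k"]) (auto simp: row_cols_simps)
    next
      fix k assume k: "k < B" "r = 7 * B + k"
      show ?thesis
        unfolding T using k succ[of k]
        by (intro two_le_card_row_cols_Diff[of "15 * B + k" _ _ "15 * B + succ_mod B k"]) (auto simp: row_cols_simps)
    qed
    finally show ?thesis .
  next
    case (4 i)
    have T: "prefix_cols (ladder_mat B) t = {..14 * B + Suc i}"
      unfolding 4 using 4 by (intro prefix_cols_rails) simp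
    have "?X t \<subseteq> {14 * B + succ_mod B (Suc i)}"
      unfolding T unfolding 4(2) row_cols_simps(2)[OF 4(1)] using 4 by auto
    then have "card (?X t) \<le> 1"
      by (rule order.trans[OF card_mono, rotated]) auto
    also have "?X r \<noteq> {}"
      using r(2)
    proof (rule row_cases)
      assume "r < 4 * B" then show ?thesis using r 4 by simp
    next
      fix k assume "k < B" "r = 4 * B + k" then show ?thesis using r 4 by simp
    next
      fix k assume k: "k < B" "r = 5 * B + k"
      then have "14 * B + k \<in> ?X r"
        unfolding T
        using r 4 by (auto simp: row_cols_simps)
      then show ?thesis by blast
    next
      fix k assume k: "k < B" "r = 6 * B + k"
      then have "15 * B + k \<in> ?X r"
        unfolding T using 4(1) by (auto simp: row_cols_simps)
      then show ?thesis by blast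
    next
      fix k assume k: "k < B" "r = 7 * B + k"
      then have "15 * B + k \<in> ?X r"
        unfolding T using 4(1) by (auto simp: row_cols_simps)
      then show ?thesis by blast
    qed
    then have "1 \<le> card (?X r)"
      using finite_row_cols by (simp add: Suc_le_eq card_gt_0_iff)
    finally show ?thesis .
  qed
qed

text \<open>The new columns are \<open>3 * t\<close> for an isolated row, P(i) for a(i), U(0) for
  q(0), and U(i+2) for q(i+1). The bound on \<open>t\<close> excludes the last q row, whose
  successor column U(0) is taken.\<close>

lemma ladder_mat_new_col:
  assumes t: "t < 6 * B - 1"
  shows "\<not> row_cols B t \<subseteq> prefix_cols (ladder_mat B) t"
proof -
  consider "t < 4 * B" | i where "i < B" "t = 4 * B + i" | "t = 5 * B"
    | i where "Suc (Suc i) < B" "t = 5 * B + Suc i"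
  proof -
    consider "t < 4 * B" | "4 * B \<le> t" "t < 5 * B" | "t = 5 * B" | "5 * B < t"
      by linarith
    then show thesis
      using that(1) that(2)[of "t - 4 * B"] that(3) that(4)[of "t - 5 * B - 1"] t
      by cases auto
  qed
  then show ?thesis
  proof cases
    case 1
    then have "3 * t \<in> row_cols B t - prefix_cols (ladder_mat B) t"
      by (simp add: prefix_cols_triples row_cols_def)
    then show ?thesis by blast
  next
    case (2 i)
    have "13 * B + i \<in> row_cols B t - prefix_cols (ladder_mat B) t"
    proof (cases i)
      case 0
      then show ?thesis
        using 2 by (simp add: prefix_cols_triples row_cols_def)
    next
      case (Suc j)
      then have "prefix_cols (ladder_mat B) t = {..12 * B + Suc j} \<union> {13 * B..13 * B + j}"
        using 2 prefix_cols_links[of j B] by simp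
      then show ?thesis
        using 2 Suc row_cols_simps(1)[OF 2(1)] by simp
    qed
    then show ?thesis by blast
  next
    case 3
    \<comment> \<open>Here \<open>5 * B < 6 * B - 1\<close> supplies the condition
      \<open>2 \<le> B\<close> of \<open>prefix_cols_all_links\<close>.\<close>
    have "14 * B \<in> row_cols B t - prefix_cols (ladder_mat B) t"
      using 3 t by (simp add: prefix_cols_all_links row_cols_def)
    then show ?thesis by blast
  next
    case (4 i)
    have "14 * B + Suc (Suc i) \<in> row_cols B t - prefix_cols (ladder_mat B) t"
      using 4 by (simp only: prefix_cols_rails row_cols_simps) (simp add: succ_mod_def)
    then show ?thesis by blast
  qed
qed

text \<open>A column met by an a or q row is met by a second one: L(i) by a(i-1) and a(i), P(i) by
  a(i) and q(i), U(i) by q(i-1) and q(i).\<close>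

lemma ladder_mat_stopping_set:
  assumes B: "2 \<le> B" and x: "x < 16 * B"
  shows "card (col_support (ladder_mat B) x \<inter> {4 * B..<6 * B}) \<noteq> 1"
proof -
  have "\<exists>r'\<in>{4 * B..<6 * B}. r' \<noteq> r \<and> x \<in> row_cols B r'"
    if r: "r \<in> {4 * B..<6 * B}" "x \<in> row_cols B r" for r
  proof -
    have "r < 8 * B"
      using r by simp
    then show ?thesis
    proof (rule row_cases)
      fix i assume i: "i < B" "r = 4 * B + i"
      then consider "x = 12 * B + i" | "x = 12 * B + succ_mod B i" | "x = 13 * B + i"
        using r by (auto simp: row_cols_simps)
      then show ?thesis
      proof cases
        case 1
        then show ?thesis
          using i pred_mod_less[OF i(1)] pred_mod_neq[OF B, of i]
          by (intro bexI[of _ "4 * B + pred_mod B i"]) (auto simp: row_cols_simps succ_pred_mod)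
      next
        case 2
        then show ?thesis
          using i succ_mod_less[OF i(1)] succ_mod_neq[OF B, of i]
          by (intro bexI[of _ "4 * B + succ_mod B i"]) (auto simp: row_cols_simps)
      next
        case 3
        then show ?thesis
          using i by (intro bexI[of _ "5 * B + i"]) (auto simp: row_cols_simps)
      qed
    next
      fix i assume i: "i < B" "r = 5 * B + i"
      then consider "x = 13 * B + i" | "x = 14 * B + i" | "x = 14 * B + succ_mod B i"
        using r by (auto simp: row_cols_simps)
      then show ?thesis
      proof cases
        case 1
        then show ?thesis
          using i by (intro bexI[of _ "4 * B + i"]) (auto simp: row_cols_simps)
      next
        case 2
        then show ?thesis
          using i pred_mod_less[OF i(1)] pred_mod_neq[OF B, of i]
          by (intro bexI[of _ "5 * B + pred_mod B i"]) (auto simp: row_cols_simps succ_pred_mod)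
      next
        case 3
        then show ?thesis
          using i succ_mod_less[OF i(1)] succ_mod_neq[OF B, of i]
          by (intro bexI[of _ "5 * B + succ_mod B i"]) (auto simp: row_cols_simps)
      qed
    qed (use r in auto)
  qed
  then have "\<exists>r'\<in>col_support (ladder_mat B) x \<inter> {4 * B..<6 * B}. r' \<noteq> r"
    if "r \<in> col_support (ladder_mat B) x \<inter> {4 * B..<6 * B}" for r
    using that unfolding col_support_ladder_mat[OF x] by fastforce
  then show ?thesis
    by (metis card_1_singletonE insertI1 singletonD)
qed

section \<open>The output and the final count\<close>

lemma pess_finder_ladder_mat:
  assumes B: "2 \<le> B"
  shows "\<exists>A. is_submatrix A (ladder_mat B) \<and> pess_finder_outputs (ladder_mat B) A \<and> 9 * B \<le> kernel_dim A"
proof -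
  \<comment> \<open>This is the last q row, at which the run halts.\<close>
  define k where "k = 6 * B - 1"
  have k: "k < 6 * B" "Suc k = 6 * B" "k = 5 * B + Suc (B - 2)"
    using B by (auto simp: k_def)
  have T: "prefix_cols (ladder_mat B) k = {..<15 * B}"
    unfolding k(3) using prefix_cols_rails[of "B - 2" B] B by auto
  have "\<exists>A. is_submatrix A (ladder_mat B) \<and> pess_finder_outputs (ladder_mat B) A
      \<and> card (prefix_cols (ladder_mat B) k) \<le> kernel_dim A + Suc k"
  proof (rule pess_finder_prefix_output[where S = "{4 * B..<6 * B}"])
    \<comment> \<open>The column V(0) is still unselected, so the loop has not ended.\<close>
    have "15 * B \<notin> {..<15 * B}" "15 * B \<in> {0..<16 * B}"
      using B by auto
    then show "prefix_cols (ladder_mat B) k \<noteq> {0..<dim_col (ladder_mat B)}"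
      unfolding T dim_ladder_mat by blast
    show "card (row_support (ladder_mat B) t - prefix_cols (ladder_mat B) t)
        \<le> card (row_support (ladder_mat B) r - prefix_cols (ladder_mat B) t)"
      if "t \<le> k" "t < r" "r < dim_row (ladder_mat B)" for t r
      using ladder_mat_lightest[OF B, of t r] that k by (simp add: row_support_ladder_mat)
    show "\<not> row_support (ladder_mat B) t \<subseteq> prefix_cols (ladder_mat B) t" if "t < k" for t
      using ladder_mat_new_col[of t B] that by (simp add: row_support_ladder_mat k_def)
    \<comment> \<open>The last q row meets P(B-1), U(B-1) and, by wrapping around, U(0), all of them
      selected.\<close>
    have "row_cols B (5 * B + (B - 1)) \<subseteq> {..<15 * B}"
      using row_cols_simps(2)[of "B - 1" B] B by (auto simp: succ_mod_def)
    then show "row_support (ladder_mat B) k \<subseteq> prefix_cols (ladder_mat B) k"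
      using B unfolding T by (simp add: row_support_ladder_mat k_def)
    show "card (col_support (ladder_mat B) x \<inter> {4 * B..<6 * B}) \<noteq> 1"
      if "x \<in> prefix_cols (ladder_mat B) k" for x
      using ladder_mat_stopping_set[OF B, of x] that unfolding T by simp
    show "k < dim_row (ladder_mat B)"
      using k(1) by simp
    show "{4 * B..<6 * B} \<noteq> {}" "{4 * B..<6 * B} \<subseteq> {0..k}"
      using B k(2) by auto
    show "k < card (prefix_cols (ladder_mat B) k)"
      unfolding T using k(1) by simp
  qed
  then show ?thesis
    unfolding T k(2) by auto
qed

theorem theorem4p1:
  shows "\<exists>(N :: nat set) (m :: nat \<Rightarrow> nat) (M :: nat \<Rightarrow> bit mat) (A :: nat \<Rightarrow> bit mat) (c :: real).
    infinite N \<and> c > 0 \<and>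
    (\<forall>n\<in>N.
       M n \<in> carrier_mat (m n) n \<and>
       (\<forall>j<n. col_weight (M n) j \<le> 3) \<and>
       is_submatrix (A n) (M n) \<and>
       pess_finder_outputs (M n) (A n) \<and>
       real (kernel_dim (M n)) \<le> real n / 2 + 2 \<and>
       real (kernel_dim (A n)) \<ge> real n / 2 + c * real n)"
proof -
  obtain A where A: "is_submatrix (A B) (ladder_mat B)" "pess_finder_outputs (ladder_mat B) (A B)"
    "9 * B \<le> kernel_dim (A B)" if "2 \<le> B" for B
    using pess_finder_ladder_mat by metis
  \<comment> \<open>From \<open>B = 2\<close> on, cyclic neighbours are distinct;
    \<open>n div 16\<close> recovers \<open>B\<close>.\<close>
  define N :: "nat set" where "N = (\<lambda>B. 16 * B) ` {2..}"
  have "infinite N"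
    unfolding N_def by (subst finite_image_iff) (auto simp: inj_on_def infinite_Ici)
  moreover have "ladder_mat (n div 16) \<in> carrier_mat (n div 2) n \<and>
       (\<forall>j<n. col_weight (ladder_mat (n div 16)) j \<le> 3) \<and>
       is_submatrix (A (n div 16)) (ladder_mat (n div 16)) \<and>
       pess_finder_outputs (ladder_mat (n div 16)) (A (n div 16)) \<and>
       real (kernel_dim (ladder_mat (n div 16))) \<le> real n / 2 + 2 \<and>
       real (kernel_dim (A (n div 16))) \<ge> real n / 2 + 1 / 16 * real n"
    if n: "n \<in> N" for n
  proof -
    obtain B where B: "2 \<le> B" "n = 16 * B"
      using n by (auto simp: N_def)
    have "real (9 * B) \<le> real (kernel_dim (A B))" "real (kernel_dim (ladder_mat B)) \<le> real (8 * B + 2)"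
      using A(3)[OF B(1)] kernel_dim_ladder_mat[OF B(1)] by (simp_all only: of_nat_le_iff)
    moreover have "n div 16 = B" "n div 2 = 8 * B"
      using B(2) by simp_all
    ultimately show ?thesis
      using A(1,2)[OF B(1)] ladder_mat_carrier[of B] col_weight_ladder_mat[of _ B] B(2) by simp
  qed
  ultimately show ?thesis
    by (intro exI[of _ N] exI[of _ "\<lambda>n. n div 2"] exI[of _ "\<lambda>n. ladder_mat (n div 16)"]
        exI[of _ "\<lambda>n. A (n div 16)"] exI[of _ "1 / 16"]) simp
qed

end
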